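(* If $n\ge m\ge 3$, then $\widehat{\chi}_{\rho}(K_m, K_n) = mn - 2m + 2$, and if $m\ge n\ge 3$, then $\widehat{\chi}_{\rho}(K_m, K_n) = mn - m - n + 2$.
   Context: For graphs $G$ and $H$ and a function $f\colon V(G)\to V(H)$, the Sierpiński product $G\otimes_f H$ is the graph with vertex set $V(G)\times V(H)$ whose edges are: $(g,h)(g,h')$ for every $g\in V(G)$ and every edge $hh'\in E(H)$; and $(g,f(g'))(g',f(g))$ for every edge $gg'\in E(G)$. Let $H^G$ denote the set of all functions $V(G)\to V(H)$. For a graph $X$, a packing $k$-coloring is a map $c\colon V(X)\to\{1,\dots,k\}$ such that whenever $u\neq v$ and $c(u)=c(v)=\ell$, the shortest-path distance satisfies $d_X(u,v)>\ell$; the packing chromatic number $\chi_\rho(X)$ is the least $k$ for which a packing $k$-coloring exists. The upper Sierpiński packing chromatic number of the pair $(G,H)$ is $\widehat{\chi}_\rho(G,H)=\max_{f\in H^G}\chi_\rho(G\otimes_f H)$. $K_m$ denotes the complete graph on $m$ vertices. *)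

theory Defs
  imports "Graph_Theory.Graph_Theory" "HOL-Library.FuncSet"
begin

text \<open>
  Graphs are symmetric loop-free digraphs: an edge \<open>uv\<close> is the pair of arcs \<open>(u, v)\<close>, \<open>(v, u)\<close>.
\<close>

definition sierpinski_product ::
    "'a pair_pre_digraph \<Rightarrow> ('a \<Rightarrow> 'b) \<Rightarrow> 'b pair_pre_digraph \<Rightarrow> ('a \<times> 'b) pair_pre_digraph" where
  "sierpinski_product G f H =
    \<lparr> pverts = pverts G \<times> pverts H,
      parcs = {((g, h), (g, h')) | g h h'. g \<in> pverts G \<and> (h, h') \<in> parcs H}
            \<union> {((g, f g'), (g', f g)) | g g'. (g, g') \<in> parcs G} \<rparr>"

lemma pair_graph_sierpinski_product:
  assumes "pair_graph G" and "pair_graph H" and "f \<in> pverts G \<rightarrow> pverts H"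
  shows "pair_graph (sierpinski_product G f H)"
proof -
  interpret G: pair_graph G by fact
  interpret H: pair_graph H by fact
  have fv: "f g \<in> pverts H" if "g \<in> pverts G" for g
    using assms(3) that by blast
  let ?V = "pverts (sierpinski_product G f H)"
  let ?A = "parcs (sierpinski_product G f H)"
  have fin: "finite ?V"
    using G.pair_finite_verts H.pair_finite_verts by (simp add: sierpinski_product_def)
  have sub: "?A \<subseteq> ?V \<times> ?V"
    by (auto simp: sierpinski_product_def intro: fv dest: G.in_arcsD1 G.in_arcsD2 H.in_arcsD1 H.in_arcsD2)
  have sym: "sym ?A"
    using G.sym_arcs H.sym_arcs
    by (auto simp: sierpinski_product_def symmetric_def sym_def)
  have loop: "fst e \<noteq> snd e" if "e \<in> ?A" for e
    using that G.pair_no_loops H.pair_no_loops by (fastforce simp: sierpinski_product_def)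
  show ?thesis
    using sub loop fin finite_subset[OF sub] sym
    by unfold_locales (auto simp: symmetric_def)
qed

text \<open>
  With unit weights, \<open>\<mu>\<close> is the shortest-path distance; it is \<open>\<infinity>\<close> between different components.
\<close>

definition graph_dist :: "'a pair_pre_digraph \<Rightarrow> 'a \<Rightarrow> 'a \<Rightarrow> ereal" where
  "graph_dist X u v = wf_digraph.\<mu> (with_proj X) (\<lambda>_. 1) u v"

definition packing_coloring :: "'a pair_pre_digraph \<Rightarrow> nat \<Rightarrow> ('a \<Rightarrow> nat) \<Rightarrow> bool" where
  "packing_coloring X k c \<longleftrightarrow>
    c \<in> pverts X \<rightarrow> {1..k} \<and>
    (\<forall>u\<in>pverts X. \<forall>v\<in>pverts X. u \<noteq> v \<and> c u = c v \<longrightarrow> graph_dist X u v > ereal (real (c u)))"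

definition packing_chromatic_number :: "'a pair_pre_digraph \<Rightarrow> nat" where
  "packing_chromatic_number X = (LEAST k. \<exists>c. packing_coloring X k c)"

definition upper_sierpinski_packing_chromatic_number ::
    "'a pair_pre_digraph \<Rightarrow> 'b pair_pre_digraph \<Rightarrow> nat" where
  "upper_sierpinski_packing_chromatic_number G H =
    Max ((\<lambda>f. packing_chromatic_number (sierpinski_product G f H)) ` (pverts G \<rightarrow>\<^sub>E pverts H))"

end

theory Submission
  imports Defs
begin

text \<open>
  The copies of \<open>H\<close> are cliques and the product has diameter at most 3, so colors 1 and 2 occur
  at most once per copy and every other color at most once altogether: a coloring is optimal when
  its first two classes \<open>A\<close> and \<open>B\<close> are as large as possible together.

  For every \<open>f\<close> one can reach \<open>|A| = m\<close> and \<open>|B| = min m n\<close>. If \<open>f\<close> is surjective, let \<open>B\<close> be the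
  points \<open>(g, f g)\<close> over a transversal of the fibers of \<open>f\<close> and \<open>A\<close> the points \<open>(g, \<sigma> (f g))\<close>, where
  \<open>\<sigma>\<close> is a cyclic shift of \<open>H\<close>. Otherwise pick \<open>x\<close> outside the image of \<open>f\<close>. The points of height \<open>x\<close>
  are incident with no edge between copies; they form \<open>B\<close> over a set \<open>S\<close> of \<open>min m n\<close> copies and
  \<open>A\<close> over the remaining ones. Over \<open>S\<close>, let \<open>A\<close> have constant height \<open>y \<noteq> x\<close>, where the fiber of \<open>y\<close>
  meets \<open>S\<close> at most once.

  Conversely, if \<open>n \<le> m\<close> and \<open>f\<close> is onto with at most one fiber of size greater than 1, over \<open>h\<^sub>0\<close>
  say, then sending \<open>(g, h) \<in> B\<close> to \<open>h\<close> if \<open>f g = h\<^sub>0\<close> and to \<open>f g\<close> otherwise is injective, so that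
  \<open>|B| \<le> n\<close>.
\<close>

section \<open>Distances as powers of a relation\<close>

text \<open>The reflexive closure lets a walk stand still, so walks of length at most
  \<open>n\<close> become chains of exactly \<open>n\<close> steps. Bounds by 1, 2 and 3 thus reduce
  to composition of relations.\<close>

lemma graph_dist_le_iff:
  assumes "pair_wf_digraph X" and u: "u \<in> pverts X"
  shows "graph_dist X u v \<le> ereal (real n) \<longleftrightarrow> (u, v) \<in> ((parcs X)\<^sup>=) ^^ n"
proof -
  interpret pair_wf_digraph X by fact
  have cost: "awalk_cost (\<lambda>_. 1) p = real (length p)" for p
    by (induction p) auto
  have walk_rel: "(w, v) \<in> ((parcs X)\<^sup>=) ^^ k" if "awalk w p v" "length p \<le> k" for w p k
    using that
  proof (induction k arbitrary: w p)
    case 0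
    then show ?case by (auto simp: awalk_Nil_iff)
  next
    case (Suc k)
    show ?case
    proof (cases p)
      case Nil
      then have "(w, v) \<in> ((parcs X)\<^sup>=) ^^ k" using Suc.prems by (intro Suc.IH[of _ "[]"]) auto
      then show ?thesis by (intro relpow_Suc_I2[of _ w]) auto
    next
      case (Cons e es)
      then have "(w, snd e) \<in> (parcs X)\<^sup>=" and "(snd e, v) \<in> ((parcs X)\<^sup>=) ^^ k"
        using Suc.prems Suc.IH[of "snd e" es] by (auto simp: awalk_Cons_iff)
      then show ?thesis by (rule relpow_Suc_I2)
    qed
  qed
  have rel_walk: "\<exists>p. awalk w p v \<and> length p \<le> k" if "(w, v) \<in> ((parcs X)\<^sup>=) ^^ k" "w \<in> pverts X" for w k
    using that
  proof (induction k arbitrary: w)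
    case 0
    then show ?case by (auto simp: awalk_Nil_iff intro!: exI[of _ "[]"])
  next
    case (Suc k)
    then obtain z where z: "(w, z) \<in> (parcs X)\<^sup>=" "(z, v) \<in> ((parcs X)\<^sup>=) ^^ k"
      by (meson relpow_Suc_D2)
    moreover have "z \<in> pverts X" using z Suc.prems by (auto dest: in_arcsD2)
    ultimately obtain p where p: "awalk z p v" "length p \<le> k" using Suc.IH by blast
    show ?case
    proof (cases "w = z")
      case True
      then show ?thesis using p by (intro exI[of _ p]) auto
    next
      case False
      then show ?thesis using p z by (intro exI[of _ "(w, z) # p"]) (auto simp: awalk_Cons_iff)
    qed
  qed
  show ?thesis
  proof
    assume "graph_dist X u v \<le> ereal (real n)"
    \<comment> \<open>An infimum yields a walk only below a strict bound; lengths being integers,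
      nothing is lost by passing to \<open>Suc n\<close>.\<close>
    also have "ereal (real n) < ereal (real (Suc n))" by simp
    finally obtain p where "awalk u p v" "real (length p) < real (Suc n)"
      unfolding graph_dist_def \<mu>_def by (auto simp: INF_less_iff cost)
    then show "(u, v) \<in> ((parcs X)\<^sup>=) ^^ n" by (intro walk_rel[of _ p]) auto
  next
    assume "(u, v) \<in> ((parcs X)\<^sup>=) ^^ n"
    then obtain p where p: "awalk u p v" "length p \<le> n" using rel_walk u by blast
    have "graph_dist X u v \<le> ereal (real (length p))"
      using min_cost_le_walk_cost[OF p(1), of "\<lambda>_. 1"] by (simp add: graph_dist_def cost)
    also have "\<dots> \<le> ereal (real n)" using p(2) by simp
    finally show "graph_dist X u v \<le> ereal (real n)" .
  qed
qed

section \<open>Packing colorings and their first two classes\<close>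

text \<open>The vertices outside \<open>A\<close> and \<open>B\<close> get pairwise distinct colors
  from 3 on, so only the two classes impose distance conditions.\<close>

lemma packing_coloring_of_two_classes:
  assumes fin: "finite (pverts X)" and sub: "A \<subseteq> pverts X" "B \<subseteq> pverts X" and disj: "A \<inter> B = {}"
    and A: "\<And>u v. u \<in> A \<Longrightarrow> v \<in> A \<Longrightarrow> u \<noteq> v \<Longrightarrow> graph_dist X u v > 1"
    and B: "\<And>u v. u \<in> B \<Longrightarrow> v \<in> B \<Longrightarrow> u \<noteq> v \<Longrightarrow> graph_dist X u v > 2"
  shows "\<exists>c. packing_coloring X (card (pverts X) - card A - card B + 2) c"
proof -
  let ?R = "pverts X - (A \<union> B)"
  have finAB: "finite A" "finite B" using fin sub by (auto intro: finite_subset)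
  have cardR: "card ?R = card (pverts X) - card A - card B"
    using sub disj finAB by (simp add: card_Diff_subset card_Un_disjoint)
  obtain e where e: "bij_betw e ?R {0..<card ?R}"
    using fin ex_bij_betw_finite_nat by blast
  define c where "c v = (if v \<in> A then 1 else if v \<in> B then 2 else e v + 3)" for v
  have "e v < card ?R" if "v \<in> ?R" for v using bij_betwE[OF e] that by auto
  then have "c \<in> pverts X \<rightarrow> {1..card ?R + 2}"
    by (force simp: c_def)
  moreover have "graph_dist X u v > ereal (real (c u))"
    if uv: "u \<in> pverts X" "v \<in> pverts X" "u \<noteq> v" "c u = c v" for u v
  proof -
    consider "u \<in> A" "v \<in> A" | "u \<in> B" "v \<in> B" "u \<notin> A" | "u \<in> ?R" "v \<in> ?R" "e u = e v"
      using uv by (auto simp: c_def split: if_splits)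
    then show ?thesis
    proof cases
      case 1
      then show ?thesis using A[of u v] uv by (simp add: c_def one_ereal_def)
    next
      case 2
      then show ?thesis using B[of u v] uv by (simp add: c_def)
    next
      case 3
      then show ?thesis using bij_betw_imp_inj_on[OF e] uv by (auto dest: inj_onD)
    qed
  qed
  ultimately show ?thesis unfolding packing_coloring_def cardR by blast
qed

text \<open>Since no distance exceeds 3, no color from 3 on can repeat, which leaves at most
  \<open>k - 2\<close> vertices outside the first two classes.\<close>

lemma card_le_of_packing_coloring:
  assumes fin: "finite (pverts X)" and c: "packing_coloring X k c"
    and diam: "\<And>u v. u \<in> pverts X \<Longrightarrow> v \<in> pverts X \<Longrightarrow> graph_dist X u v \<le> 3"
  shows "card (pverts X) \<le> card {v \<in> pverts X. c v = 1} + card {v \<in> pverts X. c v = 2} + (k - 2)"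
proof -
  let ?C1 = "{v \<in> pverts X. c v = 1}" and ?C2 = "{v \<in> pverts X. c v = 2}"
  let ?R = "{v \<in> pverts X. c v \<ge> 3}"
  have range: "c v \<in> {1..k}" if "v \<in> pverts X" for v
    using c that by (auto simp: packing_coloring_def)
  have "inj_on c ?R"
  proof (rule inj_onI, rule ccontr)
    fix u v assume uv: "u \<in> ?R" "v \<in> ?R" "c u = c v" "u \<noteq> v"
    then have "graph_dist X u v > ereal (real (c u))"
      using c by (auto simp: packing_coloring_def)
    moreover have "3 \<le> ereal (real (c u))" using uv by simp
    ultimately have "3 < graph_dist X u v" by (rule le_less_trans[rotated])
    then show False using diam[of u v] uv by (auto simp: not_le[symmetric])
  qed
  moreover have "c ` ?R \<subseteq> {3..k}" using range by auto
  ultimately have R: "card ?R \<le> k - 2"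
    using card_inj_on_le[of c ?R "{3..k}"] by simp
  have "pverts X = ?C1 \<union> ?C2 \<union> ?R" using range by force
  then have "card (pverts X) = card (?C1 \<union> ?C2 \<union> ?R)" by (rule arg_cong)
  then have "card (pverts X) \<le> card (?C1 \<union> ?C2) + card ?R"
    using card_Un_le[of "?C1 \<union> ?C2" ?R] by argo
  also have "\<dots> \<le> card ?C1 + card ?C2 + (k - 2)"
    using card_Un_le[of ?C1 ?C2] R by linarith
  finally show ?thesis .
qed

text \<open>A cyclic shift along an enumeration of \<open>S\<close> is one cycle of length at least
  3. Having no fixed points will keep \<open>A\<close> and \<open>B\<close> disjoint, having no
  2-cycles will make \<open>A\<close> independent.\<close>

lemma ex_map_without_short_cycles:
  assumes "finite S" and "card S \<ge> 3"
  obtains \<sigma> where "\<And>x. x \<in> S \<Longrightarrow> \<sigma> x \<in> S" "\<And>x. x \<in> S \<Longrightarrow> \<sigma> x \<noteq> x" "\<And>x. x \<in> S \<Longrightarrow> \<sigma> (\<sigma> x) \<noteq> x"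
proof -
  let ?n = "card S"
  obtain e where e: "bij_betw e S {0..<?n}"
    using assms(1) ex_bij_betw_finite_nat by blast
  define \<sigma> where "\<sigma> x = inv_into S e (Suc (e x) mod ?n)" for x
  have lt: "e x < ?n" if "x \<in> S" for x using bij_betwE[OF e] that by auto
  have mem: "Suc i mod ?n \<in> e ` S" for i
    using assms(2) bij_betw_imp_surj_on[OF e] by auto
  have in_S: "\<sigma> x \<in> S" for x
    unfolding \<sigma>_def using mem by (rule inv_into_into)
  have e_\<sigma>: "e (\<sigma> x) = Suc (e x) mod ?n" for x
    unfolding \<sigma>_def using mem by (rule f_inv_into_f)
  have "e (\<sigma> x) \<noteq> e x" and "e (\<sigma> (\<sigma> x)) \<noteq> e x" if "x \<in> S" for x
    using lt[OF that] assms(2) by (auto simp: e_\<sigma> mod_Suc)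
  then show ?thesis using in_S that by metis
qed

section \<open>Distances and color classes in products of complete graphs\<close>

locale complete_sierpinski =
  fixes G :: "'a pair_pre_digraph" and H :: "'b pair_pre_digraph" and f :: "'a \<Rightarrow> 'b"
  assumes complete_G: "complete_digraph (card (pverts G)) (with_proj G)"
    and complete_H: "complete_digraph (card (pverts H)) (with_proj H)"
    and f: "f \<in> pverts G \<rightarrow> pverts H"
begin

abbreviation X :: "('a \<times> 'b) pair_pre_digraph" where
  "X \<equiv> sierpinski_product G f H"

lemma finite_G: "finite (pverts G)" and finite_H: "finite (pverts H)"
  using complete_G complete_H by (auto simp: complete_digraph_pair_def)

lemma f_in: "g \<in> pverts G \<Longrightarrow> f g \<in> pverts H"
  using f by blast

lemma pverts_X: "pverts X = pverts G \<times> pverts H"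
  by (simp add: sierpinski_product_def)

lemma finite_X: "finite (pverts X)"
  using finite_G finite_H by (simp add: pverts_X)

lemma card_X: "card (pverts X) = card (pverts G) * card (pverts H)"
  by (simp add: pverts_X card_cartesian_product)

lemma arc_iff:
  "((g, h), (g', h')) \<in> parcs X \<longleftrightarrow> g \<in> pverts G \<and> g' \<in> pverts G \<and>
     (g = g' \<and> h \<in> pverts H \<and> h' \<in> pverts H \<and> h \<noteq> h' \<or> g \<noteq> g' \<and> h = f g' \<and> h' = f g)"
  using complete_G complete_H by (auto simp: complete_digraph_pair_def sierpinski_product_def)

lemma pair_wf_X: "pair_wf_digraph X"
  by unfold_locales (auto simp: arc_iff pverts_X f_in)

lemma dist_le_1_iff:
  assumes "u \<in> pverts X"
  shows "graph_dist X u v \<le> 1 \<longleftrightarrow> u = v \<or> (u, v) \<in> parcs X"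
  using graph_dist_le_iff[OF pair_wf_X assms, of v 1] by (auto simp: one_ereal_def)

text \<open>Exactly one edge joins two given copies. A path of length at most 2 either uses it, with
  at most one further step inside a copy, or visits a third copy \<open>k\<close>. In the latter
  case it must enter at \<open>(k, f g)\<close> and leave at \<open>(k, f g')\<close>, so these
  points coincide and both ends have height \<open>f k\<close>.\<close>

lemma dist_le_2_iff:
  assumes "g \<in> pverts G" "g' \<in> pverts G" "g \<noteq> g'" "h \<in> pverts H" "h' \<in> pverts H"
  shows "graph_dist X (g, h) (g', h') \<le> 2 \<longleftrightarrow>
    h = f g' \<or> h' = f g \<or> (f g = f g' \<and> h = h' \<and> h \<in> f ` (pverts G - {g, g'}))"
proof -
  have "graph_dist X (g, h) (g', h') \<le> 2 \<longleftrightarrow> ((g, h), (g', h')) \<in> (parcs X)\<^sup>= O (parcs X)\<^sup>="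
    using graph_dist_le_iff[OF pair_wf_X, of "(g, h)" "(g', h')" 2] assms
    by (simp add: pverts_X numeral_2_eq_2)
  also have "\<dots> \<longleftrightarrow> (\<exists>k y. ((g, h), (k, y)) \<in> (parcs X)\<^sup>= \<and> ((k, y), (g', h')) \<in> (parcs X)\<^sup>=)"
    by (auto simp only: relcomp_unfold mem_Collect_eq split_paired_Ex prod.case)
  also have "\<dots> \<longleftrightarrow> h = f g' \<or> h' = f g \<or> (f g = f g' \<and> h = h' \<and> h \<in> f ` (pverts G - {g, g'}))"
    (is "?L \<longleftrightarrow> ?R")
  proof
    assume ?L
    then show ?R using assms by (auto simp: arc_iff)
  next
    assume ?R
    then consider "h = f g'" | "h' = f g" | k where "f g = f g'" "h = h'" "k \<in> pverts G - {g, g'}" "h = f k"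
      by blast
    then show ?L
    proof cases
      case 1
      then show ?thesis using assms
        by (intro exI[of _ g'] exI[of _ "f g"]) (auto simp: arc_iff f_in)
    next
      case 2
      then show ?thesis using assms
        by (intro exI[of _ g] exI[of _ "f g'"]) (auto simp: arc_iff f_in)
    next
      case (3 k)
      then show ?thesis using assms
        by (intro exI[of _ k] exI[of _ "f g"]) (auto simp: arc_iff f_in)
    qed
  qed
  finally show ?thesis .
qed

lemma dist_le_3:
  assumes "u \<in> pverts X" "v \<in> pverts X"
  shows "graph_dist X u v \<le> 3"
proof -
  obtain g h g' h' where uv: "u = (g, h)" "v = (g', h')" by (metis surj_pair)
  have "(u, v) \<in> (parcs X)\<^sup>= O (parcs X)\<^sup>= O (parcs X)\<^sup>="
  proof (cases "g = g'")
    case True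
    then show ?thesis using assms by (intro relcompI[of _ v]) (auto simp: uv pverts_X arc_iff)
  next
    case False
    \<comment> \<open>The path goes to the near end of the edge joining the two copies, across it,
      and on to \<open>v\<close>.\<close>
    then show ?thesis using assms
      by (intro relcompI[of _ "(g, f g')"] relcompI[of _ "(g', f g)"])
        (auto simp: uv pverts_X arc_iff f_in)
  qed
  then show ?thesis
    using graph_dist_le_iff[OF pair_wf_X assms(1), of v 3] by (simp add: numeral_3_eq_3 O_assoc)
qed

lemma inj_on_fst_color_class:
  assumes "packing_coloring X k c" and "l \<ge> 1"
  shows "inj_on fst {v \<in> pverts X. c v = l}"
proof (rule inj_onI, rule ccontr)
  fix u v assume uv: "u \<in> {v \<in> pverts X. c v = l}" "v \<in> {v \<in> pverts X. c v = l}" "fst u = fst v" "u \<noteq> v"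
  then have "graph_dist X u v \<le> 1"
    by (cases u; cases v) (auto simp: dist_le_1_iff pverts_X arc_iff)
  also have "1 \<le> ereal (real l)" using assms(2) by (simp add: one_ereal_def)
  finally show False using assms(1) uv by (fastforce simp: packing_coloring_def)
qed

lemma card_color_class_le:
  assumes "packing_coloring X k c" and "l \<ge> 1"
  shows "card {v \<in> pverts X. c v = l} \<le> card (pverts G)"
  by (rule card_inj_on_le[OF inj_on_fst_color_class[OF assms] _ finite_G]) (auto simp: pverts_X)

lemma card_color_class_2_le:
  assumes c: "packing_coloring X k c" and surj: "f ` pverts G = pverts H"
    and fibers: "\<And>g g'. g \<in> pverts G \<Longrightarrow> g' \<in> pverts G \<Longrightarrow> g \<noteq> g' \<Longrightarrow> f g = f g' \<Longrightarrow> f g = h\<^sub>0"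
  shows "card {v \<in> pverts X. c v = 2} \<le> card (pverts H)"
proof -
  let ?C = "{v \<in> pverts X. c v = 2}"
  have far: "h \<noteq> f g'" "f g = f g' \<Longrightarrow> h \<noteq> h'"
    if gh: "(g, h) \<in> ?C" "(g', h') \<in> ?C" "g \<noteq> g'" for g h g' h'
  proof -
    have mem: "g \<in> pverts G" "g' \<in> pverts G" "h \<in> pverts H" "h' \<in> pverts H"
      using gh by (auto simp: pverts_X)
    have "graph_dist X (g, h) (g', h') > 2"
      using gh c by (fastforce simp: packing_coloring_def)
    then have *: "\<not> (h = f g' \<or> h' = f g \<or> (f g = f g' \<and> h = h' \<and> h \<in> f ` (pverts G - {g, g'})))"
      using dist_le_2_iff[of g g' h h'] mem gh(3) by (auto simp: not_le[symmetric])
    then show "h \<noteq> f g'" by blast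
    show "h \<noteq> h'" if "f g = f g'"
    proof
      assume "h = h'"
      \<comment> \<open>Were the heights equal, \<open>(x, f g)\<close> in a third copy would be a
        common neighbor of the two points.\<close>
      obtain x where x: "x \<in> pverts G" "h = f x" using surj mem by blast
      then have "x \<noteq> g" "x \<noteq> g'" using * that by auto
      then show False using * x that \<open>h = h'\<close> by blast
    qed
  qed
  define \<phi> where "\<phi> v = (if f (fst v) = h\<^sub>0 then snd v else f (fst v))" for v
  have "inj_on \<phi> ?C"
  proof (rule inj_onI, rule ccontr)
    fix u v assume uv: "u \<in> ?C" "v \<in> ?C" "\<phi> u = \<phi> v" "u \<noteq> v"
    then have ne: "fst u \<noteq> fst v"
      using inj_on_fst_color_class[OF c, of 2] by (meson inj_onD one_le_numeral)
    have fst_in: "fst u \<in> pverts G" "fst v \<in> pverts G" using uv by (auto simp: pverts_X)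
    have uv_far: "snd u \<noteq> f (fst v)" "snd v \<noteq> f (fst u)" "f (fst u) = f (fst v) \<Longrightarrow> snd u \<noteq> snd v"
      using far[of "fst u" "snd u" "fst v" "snd v"] far[of "fst v" "snd v" "fst u" "snd u"] uv(1,2) ne
      unfolding prod.collapse by metis+
    \<comment> \<open>Two points over \<open>h\<^sub>0\<close> have different heights by
      \<open>far\<close>; if just one is over \<open>h\<^sub>0\<close>, its height would be the
      value of \<open>f\<close> at the other; if neither is, \<open>fibers\<close> is
      violated.\<close>
    then show False
      using uv(3) fibers[OF fst_in ne] unfolding \<phi>_def by (auto split: if_splits)
  qed
  then show ?thesis
    by (rule card_inj_on_le[OF _ _ finite_H]) (auto simp: pverts_X f_in \<phi>_def)
qed

section \<open>Colorings with two large classes, and the matching lower bound\<close>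

text \<open>The classes are the graphs of \<open>a\<close> and \<open>b\<close>. By
  \<open>arc_iff\<close>, \<open>indep\<close> says that the first is independent;
  \<open>free\<close> and \<open>far\<close> rule out the alternatives of
  \<open>dist_le_2_iff\<close> for the second.\<close>

lemma ex_packing_coloring_of_sections:
  assumes S: "S \<subseteq> pverts G"
    and a: "a \<in> pverts G \<rightarrow> pverts H" and b: "b \<in> S \<rightarrow> pverts H"
    and ab: "\<And>g. g \<in> S \<Longrightarrow> a g \<noteq> b g"
    and indep: "\<And>g g'. g \<in> pverts G \<Longrightarrow> g' \<in> pverts G \<Longrightarrow> g \<noteq> g' \<Longrightarrow> a g = f g' \<Longrightarrow> a g' \<noteq> f g"
    and free: "\<And>g g'. g \<in> S \<Longrightarrow> g' \<in> S \<Longrightarrow> g \<noteq> g' \<Longrightarrow> b g \<noteq> f g'"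
    and far: "\<And>g g'. g \<in> S \<Longrightarrow> g' \<in> S \<Longrightarrow> g \<noteq> g' \<Longrightarrow> f g = f g' \<Longrightarrow> b g \<notin> f ` pverts G"
  shows "\<exists>c. packing_coloring X
    (card (pverts G) * card (pverts H) - card (pverts G) - card S + 2) c"
proof -
  let ?A = "(\<lambda>g. (g, a g)) ` pverts G" and ?B = "(\<lambda>g. (g, b g)) ` S"
  have card: "card ?A = card (pverts G)" "card ?B = card S"
    by (auto intro!: card_image inj_onI)
  have "\<exists>c. packing_coloring X (card (pverts X) - card ?A - card ?B + 2) c"
  proof (rule packing_coloring_of_two_classes[OF finite_X])
    show "?A \<subseteq> pverts X" "?B \<subseteq> pverts X" "?A \<inter> ?B = {}"
      using S a b ab by (auto simp: pverts_X)
  next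
    fix u v assume uv: "u \<in> ?A" "v \<in> ?A" "u \<noteq> v"
    then have "u \<in> pverts X" using a by (auto simp: pverts_X)
    moreover have "(u, v) \<notin> parcs X" using uv indep by (auto simp: arc_iff)
    ultimately show "graph_dist X u v > 1" using uv dist_le_1_iff[of u v] by (simp add: not_le)
  next
    fix u v assume "u \<in> ?B" "v \<in> ?B" "u \<noteq> v"
    then obtain g g' where g: "u = (g, b g)" "v = (g', b g')" "g \<in> S" "g' \<in> S" "g \<noteq> g'" by blast
    have "\<not> graph_dist X u v \<le> 2"
      unfolding g(1,2)
      by (subst dist_le_2_iff) (use g S b free far in \<open>blast+\<close>)
    then show "graph_dist X u v > 2" by (simp add: not_le)
  qed
  then show ?thesis by (simp add: card card_X)
qed

lemma ex_packing_coloring: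
  assumes n: "card (pverts H) \<ge> 3"
  shows "\<exists>c. packing_coloring X (card (pverts G) * card (pverts H)
    - card (pverts G) - min (card (pverts G)) (card (pverts H)) + 2) c"
proof (cases "f ` pverts G = pverts H")
  case True
  obtain S where S: "S \<subseteq> pverts G" "inj_on f S" "f ` S = pverts H"
    using True by (metis subset_image_inj order_refl)
  have card_S: "card S = card (pverts H)" using S by (metis card_image)
  have "card (pverts H) \<le> card (pverts G)"
    using card_mono[OF finite_G S(1)] card_S by simp
  then have min: "min (card (pverts G)) (card (pverts H)) = card S" using card_S by simp
  obtain \<sigma> where \<sigma>: "\<And>x. x \<in> pverts H \<Longrightarrow> \<sigma> x \<in> pverts H" "\<And>x. x \<in> pverts H \<Longrightarrow> \<sigma> x \<noteq> x"
    "\<And>x. x \<in> pverts H \<Longrightarrow> \<sigma> (\<sigma> x) \<noteq> x"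
    using ex_map_without_short_cycles[OF finite_H n] by blast
  show ?thesis unfolding min
  proof (rule ex_packing_coloring_of_sections[where a = "\<lambda>g. \<sigma> (f g)" and b = f, OF S(1)])
    \<comment> \<open>An edge inside the first class would make \<sigma> exchange \<open>f g\<close>
      and \<open>f g'\<close>. The condition \<open>far\<close> is vacuous, since \<open>f\<close>
      is injective on \<open>S\<close>.\<close>
    show "\<sigma> (f g') \<noteq> f g" if "g \<in> pverts G" "\<sigma> (f g) = f g'" for g g'
      using \<sigma>(3)[OF f_in[OF that(1)]] that(2) by simp
  qed (use S \<sigma> f_in in \<open>auto dest: inj_onD\<close>)
next
  case False
  then obtain x where x: "x \<in> pverts H" "x \<notin> f ` pverts G" using f_in by blast
  obtain S where S: "S \<subseteq> pverts G" "card S = min (card (pverts G)) (card (pverts H))"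
    using obtain_subset_with_card_n[of "min (card (pverts G)) (card (pverts H))" "pverts G"] by auto
  have fin_S: "finite S" using S(1) finite_G by (rule finite_subset)
  \<comment> \<open>Otherwise \<open>S\<close> would meet all \<open>n - 1\<close> fibers at least twice, but \<open>2 (n - 1) > n \<ge> card S\<close>.\<close>
  have "\<exists>y \<in> pverts H - {x}. card {g \<in> S. f g = y} \<le> 1"
  proof (rule ccontr)
    assume "\<not> ?thesis"
    then have "(\<Sum>y\<in>pverts H - {x}. 2) \<le> (\<Sum>y\<in>pverts H - {x}. card {g \<in> S. f g = y})"
      by (intro sum_mono) force
    also have "\<dots> = card S"
      using sum.group[OF fin_S, of "pverts H - {x}" f "\<lambda>_. 1::nat"] finite_H S(1) x f_in by force
    finally have "2 * (card (pverts H) - 1) \<le> card (pverts H)"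
      using x finite_H S(2) by (simp add: mult.commute)
    then show False using n by linarith
  qed
  then obtain y where y: "y \<in> pverts H" "y \<noteq> x" "card {g \<in> S. f g = y} \<le> 1" by blast
  have y_unique: "g = g'" if "g \<in> S" "g' \<in> S" "f g = y" "f g' = y" for g g'
    using y(3) fin_S that card_le_Suc0_iff_eq[of "{g \<in> S. f g = y}"] by auto
  show ?thesis unfolding S(2)[symmetric]
  proof (rule ex_packing_coloring_of_sections[where a = "\<lambda>g. if g \<in> S then y else x" and b = "\<lambda>_. x",
        OF S(1)])
    \<comment> \<open>As \<open>x\<close> is not a value of \<open>f\<close>, an edge forces
      \<open>g\<close> and \<open>g'\<close> into \<open>S\<close> and both into the fiber of
      \<open>y\<close>, which meets \<open>S\<close> at most once.\<close>
    fix g g' assume "g \<in> pverts G" "g' \<in> pverts G" "g \<noteq> g'" "(if g \<in> S then y else x) = f g'"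
    then show "(if g' \<in> S then y else x) \<noteq> f g"
      using x(2) y_unique[of g g'] by (metis image_eqI)
  qed (use S(1) x y(1,2) in auto)
qed

lemma packing_chromatic_number_le:
  assumes "card (pverts H) \<ge> 3"
  shows "packing_chromatic_number X \<le> card (pverts G) * card (pverts H)
    - card (pverts G) - min (card (pverts G)) (card (pverts H)) + 2"
  unfolding packing_chromatic_number_def using ex_packing_coloring[OF assms] by (rule Least_le)

lemma le_packing_chromatic_number:
  assumes n: "card (pverts H) \<ge> 3" and m: "card (pverts G) > 0"
    and two: "\<And>k c. packing_coloring X k c \<Longrightarrow> card {v \<in> pverts X. c v = 2} \<le> d"
    and d: "d \<le> card (pverts G)"
  shows "card (pverts G) * card (pverts H) - card (pverts G) - d + 2 \<le> packing_chromatic_number X"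
proof -
  let ?k = "packing_chromatic_number X"
  let ?mn = "card (pverts G) * card (pverts H)"
  obtain c where c: "packing_coloring X ?k c"
    unfolding packing_chromatic_number_def
    using LeastI_ex[of "\<lambda>k. \<exists>c. packing_coloring X k c"] ex_packing_coloring[OF n] by blast
  have "?mn \<le> card {v \<in> pverts X. c v = 1} + card {v \<in> pverts X. c v = 2} + (?k - 2)"
    using card_le_of_packing_coloring[OF finite_X c dist_le_3] by (simp add: card_X)
  then have "?mn \<le> card (pverts G) + d + (?k - 2)"
    using card_color_class_le[OF c, of 1] two[OF c] by linarith
  \<comment> \<open>Since \<open>d\<close> is at most the number of copies, this forces
    \<open>?k - 2\<close> to be positive, so the subtraction is not truncated.\<close>
  moreover have "3 * card (pverts G) \<le> ?mn" using n by simp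
  ultimately show ?thesis using m d by linarith
qed

end

section \<open>The extremal function and the maximum\<close>

text \<open>Invert an injection of \<open>B\<close> into \<open>A\<close> on its image and send all
  remaining points to a single \<open>b\<close>.\<close>

lemma ex_surj_with_one_large_fiber:
  assumes "finite A" "finite B" "card B \<le> card A" "B \<noteq> {}"
  obtains f b where "f \<in> A \<rightarrow>\<^sub>E B" "f ` A = B"
    "\<And>x y. x \<in> A \<Longrightarrow> y \<in> A \<Longrightarrow> x \<noteq> y \<Longrightarrow> f x = f y \<Longrightarrow> f x = b"
proof -
  obtain e where e: "e ` B \<subseteq> A" "inj_on e B"
    using card_le_inj[OF assms(2,1,3)] by blast
  obtain b where b: "b \<in> B" using assms(4) by blast
  define f where "f = (\<lambda>x\<in>A. if x \<in> e ` B then inv_into B e x else b)"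
  have f: "f \<in> A \<rightarrow>\<^sub>E B" using b by (auto simp: f_def inv_into_into)
  have "y \<in> f ` A" if "y \<in> B" for y
    using that e by (intro image_eqI[of _ _ "e y"]) (auto simp: f_def)
  then have "f ` A = B" using f by blast
  moreover have "f x = b" if "x \<in> A" "y \<in> A" "x \<noteq> y" "f x = f y" for x y
    using that by (auto simp: f_def inv_into_f_f[OF e(2)] split: if_splits)
  ultimately show ?thesis using that f by blast
qed

lemma upper_sierpinski_packing_chromatic_number_complete:
  assumes G: "complete_digraph m (with_proj G)" and H: "complete_digraph n (with_proj H)"
    and n: "n \<ge> 3" and m: "m > 0"
  shows "upper_sierpinski_packing_chromatic_number G H = m * n - m - min m n + 2"
proof -
  have card: "card (pverts G) = m" "card (pverts H) = n" and fin: "finite (pverts G)" "finite (pverts H)"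
    using G H by (auto simp: complete_digraph_pair_def)
  have loc: "complete_sierpinski G H f" if "f \<in> pverts G \<rightarrow>\<^sub>E pverts H" for f
    using that G H card by (auto simp: complete_sierpinski_def)
  have ne: "pverts H \<noteq> {}" using card n by auto
  have "\<exists>f \<in> pverts G \<rightarrow>\<^sub>E pverts H. \<forall>k c. packing_coloring (sierpinski_product G f H) k c \<longrightarrow>
      card {v \<in> pverts (sierpinski_product G f H). c v = 2} \<le> min m n"
  proof (cases "n \<le> m")
    case True
    then obtain f b where f: "f \<in> pverts G \<rightarrow>\<^sub>E pverts H" "f ` pverts G = pverts H"
      "\<And>g g'. g \<in> pverts G \<Longrightarrow> g' \<in> pverts G \<Longrightarrow> g \<noteq> g' \<Longrightarrow> f g = f g' \<Longrightarrow> f g = b"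
      using ex_surj_with_one_large_fiber[OF fin _ ne] card by metis
    show ?thesis
      using f(1) True complete_sierpinski.card_color_class_2_le[OF loc[OF f(1)] _ f(2,3)] card
      by (auto intro!: bexI[of _ f])
  next
    case False
    \<comment> \<open>With fewer copies than heights any \<open>f\<close> is extremal: one point per
      copy already gives the bound \<open>m = min m n\<close>.\<close>
    obtain f where f: "f \<in> pverts G \<rightarrow>\<^sub>E pverts H"
      using ne by (metis PiE_eq_empty_iff ex_in_conv)
    show ?thesis
      using f False complete_sierpinski.card_color_class_le[OF loc[OF f], of _ _ 2] card
      by (auto intro!: bexI[of _ f])
  qed
  then obtain f where f: "f \<in> pverts G \<rightarrow>\<^sub>E pverts H"
    and two: "\<And>k c. packing_coloring (sierpinski_product G f H) k c \<Longrightarrow>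
      card {v \<in> pverts (sierpinski_product G f H). c v = 2} \<le> min m n"
    by blast
  have le: "packing_chromatic_number (sierpinski_product G f' H) \<le> m * n - m - min m n + 2"
    if "f' \<in> pverts G \<rightarrow>\<^sub>E pverts H" for f'
    using complete_sierpinski.packing_chromatic_number_le[OF loc[OF that]] n card by simp
  have "m * n - m - min m n + 2 \<le> packing_chromatic_number (sierpinski_product G f H)"
    using complete_sierpinski.le_packing_chromatic_number[OF loc[OF f], of "min m n"] two n m card by simp
  then have "packing_chromatic_number (sierpinski_product G f H) = m * n - m - min m n + 2"
    using le[OF f] by simp
  then show ?thesis
    unfolding upper_sierpinski_packing_chromatic_number_def
    using f le finite_PiE[OF fin(1), of "\<lambda>_. pverts H"] fin(2)
    by (intro Max_eqI) (auto intro!: image_eqI[of _ _ f])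
qed

theorem theorem3p5:
  fixes G :: "'a pair_pre_digraph" and H :: "'b pair_pre_digraph" and m n :: nat
  assumes "complete_digraph m (with_proj G)" and "complete_digraph n (with_proj H)"
  shows "(n \<ge> m \<and> m \<ge> 3 \<longrightarrow>
            int (upper_sierpinski_packing_chromatic_number G H) = int m * int n - 2 * int m + 2) \<and>
         (m \<ge> n \<and> n \<ge> 3 \<longrightarrow>
            int (upper_sierpinski_packing_chromatic_number G H) = int m * int n - int m - int n + 2)"
proof -
  have "int (upper_sierpinski_packing_chromatic_number G H) = int m * int n - int m - int (min m n) + 2"
    if "m \<ge> 3" "n \<ge> 3"
  proof -
    \<comment> \<open>This makes the subtractions on naturals exact, so that the formula carries
      over to the integers.\<close>
    have "m + min m n \<le> 3 * m" by simp
    also have "\<dots> \<le> m * n" using that by simp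
    finally show ?thesis
      using upper_sierpinski_packing_chromatic_number_complete[OF assms] that
      by (simp add: of_nat_diff)
  qed
  then show ?thesis by auto
qed

end
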